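(* Let $F\in1+q\mathbb F_2[[q]]$ have degree $2$ over $\mathbb F_2(q)$. Define recursively $F_1=F$ and, for $i\ge1$, $$a_i:=1+\min\{j\ge1:\ [q^j]F_i=0\},\qquad F_{i+1}:=\frac{q^{a_i-1}}{[a_i]_q-F_i}.$$ Every $F_i$ then also has degree $2$ over $\mathbb F_2(q)$; for each $i$ let $A_iT^2+B_iT+C_i\in\mathbb F_2[q][T]$ be the unique primitive irreducible polynomial satisfied by $F_i$. Then the sequence $(a_i)$ is eventually periodic if and only if the three sequences $(\deg A_i)$, $(\deg B_i)$, $(\deg C_i)$ are bounded.
   Context: $[q^j]F$ denotes the coefficient of $q^j$ in $F$, and $[a]_q=1+q+\cdots+q^{a-1}$ (here reduced mod 2). "Degree $2$ over $\mathbb F_2(q)$" means algebraic of degree exactly $2$ over the field $\mathbb F_2(q)\subset\mathbb F_2((q))$. The recursion is well defined for all $i$: each $F_i$ lies in $1+q\mathbb F_2[[q]]$ and is different from $\sum_{j\ge0}q^j$ (the latter is rational). Boundedness of degrees means bounded above, with $\deg 0=-\infty$. (The sequence $(a_i)$ is the negative continued-fraction code of the real number whose $q$-analogue reduces to $F$ modulo $2$.) *)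

theory Defs
  imports
    "HOL-Computational_Algebra.Computational_Algebra"
    "HOL-Computational_Algebra.Field_as_Ring"
    "HOL-Library.Z2"
begin

text \<open>
  The library has no gcd structure on the field \<^typ>\<open>bit\<close> of two elements. The following instance
  (the same as the library's instance for the reals) makes \<^typ>\<open>bit poly\<close> a factorial ring with gcd,
  so that \<^const>\<open>content\<close> is available on \<^typ>\<open>bit poly poly\<close>.
\<close>

instantiation bit ::
  "{unique_euclidean_ring, normalization_euclidean_semiring, normalization_semidom_multiplicative}"
begin

definition [simp]: "normalize_bit = (normalize_field :: bit \<Rightarrow> _)"
definition [simp]: "unit_factor_bit = (unit_factor_field :: bit \<Rightarrow> _)"
definition [simp]: "euclidean_size_bit = (euclidean_size_field :: bit \<Rightarrow> _)"
definition [simp]: "division_segment (x :: bit) = 1"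

instance
  by standard (auto simp: dvd_field_iff)

end

instantiation bit :: euclidean_ring_gcd
begin

definition gcd_bit :: "bit \<Rightarrow> bit \<Rightarrow> bit" where
  "gcd_bit = Euclidean_Algorithm.gcd"
definition lcm_bit :: "bit \<Rightarrow> bit \<Rightarrow> bit" where
  "lcm_bit = Euclidean_Algorithm.lcm"
definition Gcd_bit :: "bit set \<Rightarrow> bit" where
  "Gcd_bit = Euclidean_Algorithm.Gcd"
definition Lcm_bit :: "bit set \<Rightarrow> bit" where
  "Lcm_bit = Euclidean_Algorithm.Lcm"

instance
  by standard (simp_all add: gcd_bit_def lcm_bit_def Gcd_bit_def Lcm_bit_def)

end

instance bit :: field_gcd ..

definition rational_functions :: "'a::field fls set" where
  "rational_functions =
     {fps_to_fls (fps_of_poly p) / fps_to_fls (fps_of_poly r) | p r. r \<noteq> 0}"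

text \<open>
  \<open>K\<close> is meant to be a subfield; the least degree of a nonzero polynomial over \<open>K\<close> that vanishes
  at \<open>x\<close> is the degree of the minimal polynomial of \<open>x\<close>.
\<close>

definition has_degree_over :: "'a::field set \<Rightarrow> 'a \<Rightarrow> nat \<Rightarrow> bool" where
  "has_degree_over K x n \<longleftrightarrow>
     (\<exists>p. p \<noteq> 0 \<and> (\<forall>i. coeff p i \<in> K) \<and> poly p x = 0 \<and> degree p = n) \<and>
     (\<forall>p. p \<noteq> 0 \<and> (\<forall>i. coeff p i \<in> K) \<and> poly p x = 0 \<longrightarrow> n \<le> degree p)"

abbreviation quadratic_series :: "bit fps \<Rightarrow> bool" where
  "quadratic_series F \<equiv> has_degree_over rational_functions (fps_to_fls F) 2"

definition q_int :: "nat \<Rightarrow> 'a::comm_ring_1 fps" where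
  "q_int a = (\<Sum>j<a. fps_X ^ j)"

definition cf_digit :: "bit fps \<Rightarrow> nat" where
  "cf_digit F = 1 + (LEAST j. 1 \<le> j \<and> fps_nth F j = 0)"

text \<open>
  The division is exact in \<open>bit fps\<close>, so it agrees with the division in the field of formal Laurent
  series; see \<open>cf_step_exact\<close> and
  \<open>quadratic_series_has_zero_coeff\<close> below.
\<close>

definition cf_step :: "bit fps \<Rightarrow> bit fps" where
  "cf_step F = fps_X ^ (cf_digit F - 1) / (q_int (cf_digit F) - F)"

text \<open>
  Indices start at 0: \<open>cf_tail F i\<close> and \<open>cf_code F i\<close> are $F_{i+1}$ and $a_{i+1}$ in the usual
  1-based numbering.
\<close>

definition cf_tail :: "bit fps \<Rightarrow> nat \<Rightarrow> bit fps" where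
  "cf_tail F i = (cf_step ^^ i) F"

definition cf_code :: "bit fps \<Rightarrow> nat \<Rightarrow> nat" where
  "cf_code F i = cf_digit (cf_tail F i)"

definition is_primitive_irreducible_of :: "bit fps \<Rightarrow> bit poly poly \<Rightarrow> bool" where
  "is_primitive_irreducible_of F P \<longleftrightarrow>
     content P = 1 \<and> irreducible P \<and> poly (map_poly fps_of_poly P) F = 0"

definition primitive_irreducible_of :: "bit fps \<Rightarrow> bit poly poly" where
  "primitive_irreducible_of F = (THE P. is_primitive_irreducible_of F P)"

definition eventually_periodic :: "(nat \<Rightarrow> 'a) \<Rightarrow> bool" where
  "eventually_periodic a \<longleftrightarrow> (\<exists>N p. p > 0 \<and> (\<forall>i\<ge>N. a (i + p) = a i))"

text \<open>
  In \<^typ>\<open>nat\<close> the zero polynomial has degree \<open>0\<close> instead of minus infinity, which makes no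
  difference for boundedness from above.
\<close>

definition bounded_degrees :: "(nat \<Rightarrow> 'a::zero poly) \<Rightarrow> bool" where
  "bounded_degrees p \<longleftrightarrow> bdd_above (range (\<lambda>i. degree (p i)))"

lemma fps_nth_q_int: "fps_nth (q_int a) n = (if n < a then 1 else 0)"
  by (simp add: q_int_def fps_sum_nth)

lemma cf_step_exact:
  fixes F :: "bit fps"
  assumes F0: "fps_nth F 0 = 1" and ex: "\<exists>j\<ge>1. fps_nth F j = 0"
  shows "q_int (cf_digit F) - F \<noteq> 0"
    and "cf_step F * (q_int (cf_digit F) - F) = fps_X ^ (cf_digit F - 1)"
    and "fps_to_fls (cf_step F) =
           fls_X ^ (cf_digit F - 1) / fps_to_fls (q_int (cf_digit F) - F)"
    and "fps_nth (cf_step F) 0 = 1"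
proof -
  define m where "m = (LEAST j. 1 \<le> j \<and> fps_nth F j = 0)"
  define G where "G = q_int (cf_digit F) - F"
  have a: "cf_digit F = Suc m" by (simp add: cf_digit_def m_def)
  have m: "1 \<le> m" "fps_nth F m = 0"
    using LeastI_ex[of "\<lambda>j. 1 \<le> j \<and> fps_nth F j = 0"] ex unfolding m_def by auto
  have lt: "fps_nth F j = 1" if "j < m" for j
    using not_less_Least[of j "\<lambda>j. 1 \<le> j \<and> fps_nth F j = 0"] that F0
    unfolding m_def by (cases "j = 0") auto
  have Gm: "fps_nth G m = 1" using m by (simp add: G_def a fps_nth_q_int)
  have Glt: "fps_nth G j = 0" if "j < m" for j
    using that lt[OF that] by (simp add: G_def a fps_nth_q_int)
  have sd: "subdegree G = m" by (rule subdegreeI) (use Gm Glt in auto)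
  show G0: "q_int (cf_digit F) - F \<noteq> 0" using Gm unfolding G_def by auto
  have dvd: "G dvd fps_X ^ m"
    using G0 sd by (subst fps_dvd_iff) (auto simp: G_def)
  have eq: "cf_step F * G = fps_X ^ m"
    using dvd unfolding cf_step_def G_def[symmetric] by (simp add: a)
  then show "cf_step F * (q_int (cf_digit F) - F) = fps_X ^ (cf_digit F - 1)"
    by (simp add: G_def a)
  have "fps_to_fls (cf_step F) * fps_to_fls G = fls_X ^ m"
    by (metis eq fls_times_fps_to_fls fps_to_fls_power fps_X_to_fls)
  then show "fps_to_fls (cf_step F) =
      fls_X ^ (cf_digit F - 1) / fps_to_fls (q_int (cf_digit F) - F)"
    using G0 by (simp add: G_def a field_simps)
  have "fps_nth (cf_step F * G) m = (\<Sum>i=0..m. fps_nth (cf_step F) i * fps_nth G (m - i))"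
    by (simp add: fps_mult_nth)
  also have "\<dots> = (\<Sum>i\<in>{0}. fps_nth (cf_step F) i * fps_nth G (m - i))"
    by (rule sum.mono_neutral_right) (use Glt in auto)
  also have "\<dots> = fps_nth (cf_step F) 0 * fps_nth G m"
    by (subst sum.insert) simp_all
  finally have "fps_nth (cf_step F) 0 * fps_nth G m = 1"
    unfolding eq by simp
  then show "fps_nth (cf_step F) 0 = 1" unfolding Gm by simp
qed

lemma quadratic_series_has_zero_coeff:
  assumes F0: "fps_nth F 0 = 1" and quad: "quadratic_series F"
  shows "\<exists>j\<ge>1. fps_nth F j = 0"
proof (rule ccontr)
  assume "\<not> ?thesis"
  then have one: "fps_nth F j = 1" for j
    using F0 by (cases "j = 0") auto
  let ?r = "[:1, -1:] :: bit poly"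
  have r: "fps_of_poly ?r = 1 - fps_X" by (simp add: fps_of_poly_pCons)
  have "F * fps_of_poly ?r = F - fps_X * F" unfolding r by (simp add: algebra_simps)
  also have "\<dots> = 1"
  proof (rule fps_ext)
    fix n
    show "fps_nth (F - fps_X * F) n = fps_nth 1 n"
      by (cases n) (simp_all add: one)
  qed
  finally have "F * fps_of_poly ?r = 1" .
  then have "fps_to_fls F * fps_to_fls (fps_of_poly ?r) = 1"
    by (metis fls_times_fps_to_fls fps_one_to_fls)
  then have "fps_to_fls F = fps_to_fls (fps_of_poly 1) / fps_to_fls (fps_of_poly ?r)"
    by (metis divide_eq_eq fps_of_poly_1 fps_one_to_fls mult_zero_right nonzero_eq_divide_eq zero_neq_one)
  moreover have "?r \<noteq> 0" by simp
  ultimately have x: "fps_to_fls F \<in> rational_functions"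
    unfolding rational_functions_def by blast
  have K01: "0 \<in> (rational_functions :: bit fls set)" "1 \<in> (rational_functions :: bit fls set)"
    unfolding rational_functions_def
    by (rule CollectI, rule exI[of _ 0], rule exI[of _ 1], simp,
        rule CollectI, rule exI[of _ 1], rule exI[of _ 1], simp)
  have negx: "- fps_to_fls F \<in> rational_functions"
  proof -
    have "- fps_to_fls F = fps_to_fls F" by (rule fls_eqI) simp
    then show ?thesis using x by (simp only:)
  qed
  let ?p = "[:- fps_to_fls F, 1:]"
  have "coeff ?p i \<in> rational_functions" for i
    using negx K01 by (auto simp: coeff_pCons split: nat.splits)
  then have "2 \<le> degree ?p"
    using quad unfolding has_degree_over_def by (metis (no_types, lifting) add.left_inverse mult.right_neutral
        mult_zero_right one_neq_zero pCons_eq_0_iff poly_0 poly_pCons add.right_neutral)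
  then show False by simp
qed

end

theory Submission
  imports Defs
begin

text \<open>
  Both directions go through a third condition: only finitely many different tails occur
  among the $F_i$.

  Periodicity is equivalent to finiteness of the set of tails because a tail and its code determine
  each other. That the tail determines its code is the definition. Conversely, let $F$ and $G$ have
  the same first digit $a$, and let $F'$, $G'$ be their successors. Subtracting
  $F = [a]_q - q^{a-1}/F'$ and $G = [a]_q - q^{a-1}/G'$ gives
  $(F - G) F' G' = q^{a-1} (F' - G')$. Here $F'$ and $G'$ are units and $a \ge 2$, so $F$ and $G$
  agree to higher order at $0$ than $F'$ and $G'$ do; two series with the same code
  therefore agree to every order (\<open>cf_code_inject\<close>). If now the code is periodic from $N$
  on with period $p$, then the tails at $N$ and $N + p$ coincide, and from then on the sequence of
  tails is periodic as well. In the other direction, finitely many tails force two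
  of them to coincide, and equal tails have equal codes.

  Bounded degrees are equivalent to finiteness of the set of tails because there are only finitely
  many triples $(A, B, C)$ of polynomials over the field of two elements with degrees below
  a given bound, and each of them has at most two roots. The converse holds since the
  polynomial is a function of the tail.

  Both equivalences need that each tail is again quadratic with constant term 1, which keeps
  the recursion going. The step $F \mapsto q^{a-1}/([a]_q - F)$ is a Moebius transformation
  with polynomial coefficients and nonzero determinant, so it preserves the degree over the rational
  functions (\<open>quadratic_moebius\<close>). The primitive irreducible polynomial is the
  primitive part of any integral equation of degree 2; it divides every other
  integral equation by pseudo-division and Gauss's lemma, and it is unique on the nose, not only up
  to associates, because 1 is the only unit (\<open>unique_primitive_irreducible\<close>).
\<close>

section \<open>Evaluating polynomials over the polynomial ring at a power series\<close>

abbreviation eval_series :: "'a::field poly poly \<Rightarrow> 'a fps \<Rightarrow> 'a fps" where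
  "eval_series P F \<equiv> poly (map_poly fps_of_poly P) F"

lemma eval_series_pCons:
  "eval_series (pCons c P) F = fps_of_poly c + F * eval_series P F"
  by (simp add: map_poly_pCons)

lemma eval_series_add: "eval_series (P + Q) F = eval_series P F + eval_series Q F"
proof -
  have "map_poly fps_of_poly (P + Q) = map_poly fps_of_poly P + map_poly fps_of_poly Q"
    by (rule poly_eqI) (simp add: coeff_map_poly fps_of_poly_add)
  then show ?thesis by simp
qed

lemma eval_series_smult: "eval_series (smult c P) F = fps_of_poly c * eval_series P F"
  by (simp add: map_poly_smult fps_of_poly_mult)

lemma eval_series_mult: "eval_series (P * Q) F = eval_series P F * eval_series Q F"
proof (induction P)
  case 0
  show ?case by simp
next
  case (pCons c P)
  have "pCons c P * Q = smult c Q + pCons 0 (P * Q)" by (rule mult_pCons_left)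
  then show ?case
    by (simp only: eval_series_add eval_series_smult eval_series_pCons pCons)
       (simp add: algebra_simps)
qed

lemma poly_degree_le_1E:
  assumes "degree P \<le> 1"
  obtains b c where "P = [:c, b:]"
proof
  show "P = [:coeff P 0, coeff P 1:]"
    by (rule poly_eqI) (use assms in \<open>auto simp: coeff_pCons coeff_eq_0 split: nat.splits\<close>)
qed

lemma poly_degree_le_2E:
  assumes "degree P \<le> 2"
  obtains a b c where "P = [:c, b, a:]"
proof
  show "P = [:coeff P 0, coeff P 1, coeff P 2:]"
  proof (rule poly_eqI)
    fix n :: nat
    consider "n = 0" | "n = 1" | "n = 2" | "n > 2" by linarith
    then show "coeff P n = coeff [:coeff P 0, coeff P 1, coeff P 2:] n"
      by cases (use assms in \<open>auto simp: coeff_pCons numeral_2_eq_2 coeff_eq_0 split: nat.splits\<close>)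
  qed
qed

section \<open>Algebraic degree over the rational functions\<close>

lemma clear_denominators:
  fixes p :: "'a::field fls poly"
  assumes "\<And>i. coeff p i \<in> rational_functions"
  shows "\<exists>d P. d \<noteq> 0 \<and>
    map_poly (\<lambda>c. fps_to_fls (fps_of_poly c)) P = smult (fps_to_fls (fps_of_poly d)) p"
  using assms
proof (induction p)
  case 0
  show ?case by (intro exI[of _ 1] exI[of _ 0]) simp
next
  case (pCons a p)
  let ?e = "\<lambda>c::'a poly. fps_to_fls (fps_of_poly c)"
  have "coeff p i \<in> rational_functions" for i
    using pCons.prems[of "Suc i"] by simp
  then obtain d P where d: "d \<noteq> 0" and P: "map_poly ?e P = smult (?e d) p"
    using pCons.IH by blast
  have "a \<in> rational_functions" using pCons.prems[of 0] by simp
  then obtain u r where r: "r \<noteq> 0" and a: "a = ?e u / ?e r"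
    unfolding rational_functions_def by blast
  have er: "?e r \<noteq> 0" using r by (simp add: fps_of_poly_eq_iff[of r 0, simplified])
  have mult: "?e (x * y) = ?e x * ?e y" for x y
    by (simp add: fps_of_poly_mult fls_times_fps_to_fls)
  have "map_poly ?e (pCons (u * d) (smult r P)) = pCons (?e (u * d)) (smult (?e r) (map_poly ?e P))"
    by (simp add: map_poly_pCons map_poly_smult mult)
  also have "\<dots> = smult (?e (r * d)) (pCons a p)"
    using er by (simp add: P a mult)
  finally show ?case using d r by (metis mult_eq_0_iff)
qed

text \<open>
  Multiplying by a common denominator changes neither the degree of an equation nor its roots, so the
  degree of a power series can be computed with integral equations, that is, with polynomials
  over the polynomial ring. This moves all later arguments from Laurent series to power series.
\<close>

lemma has_degree_over_rational_functions_iff: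
  fixes F :: "'a::field fps"
  shows "has_degree_over rational_functions (fps_to_fls F) n \<longleftrightarrow>
    (\<exists>P. P \<noteq> 0 \<and> eval_series P F = 0 \<and> degree P = n) \<and>
    (\<forall>P. P \<noteq> 0 \<and> eval_series P F = 0 \<longrightarrow> n \<le> degree P)"
proof -
  let ?e = "\<lambda>c::'a poly. fps_to_fls (fps_of_poly c)"
  let ?K = "rational_functions :: 'a fls set"
  have e0: "?e c = 0 \<longleftrightarrow> c = 0" for c
    by (simp add: fps_of_poly_eq_iff[of c 0, simplified])
  have ev: "poly (map_poly ?e P) (fps_to_fls F) = fps_to_fls (eval_series P F)" for P
    by (induction P) (simp_all add: map_poly_pCons fls_times_fps_to_fls)
  have "?e c \<in> ?K" for c
    unfolding rational_functions_def by (rule CollectI, rule exI[of _ c], rule exI[of _ 1]) simp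
  then have up: "map_poly ?e P \<noteq> 0 \<and> (\<forall>i. coeff (map_poly ?e P) i \<in> ?K) \<and>
      poly (map_poly ?e P) (fps_to_fls F) = 0 \<and> degree (map_poly ?e P) = degree P"
    if "P \<noteq> 0" "eval_series P F = 0" for P
    using that e0 by (simp add: map_poly_eq_0_iff coeff_map_poly ev degree_map_poly)
  have down: "\<exists>P. P \<noteq> 0 \<and> eval_series P F = 0 \<and> degree P = degree p"
    if p: "p \<noteq> 0" "\<forall>i. coeff p i \<in> ?K" "poly p (fps_to_fls F) = 0" for p
  proof -
    obtain d P where d: "d \<noteq> 0" and P: "map_poly ?e P = smult (?e d) p"
      using clear_denominators[of p] p(2) by blast
    have "fps_to_fls (eval_series P F) = 0"
      using p(3) by (simp flip: ev add: P)
    moreover have "degree P = degree p"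
      using arg_cong[OF P, of degree] d e0 by (simp add: degree_map_poly)
    moreover have "P \<noteq> 0"
      using P d e0 p(1) by auto
    ultimately show ?thesis by auto
  qed
  show ?thesis
    unfolding has_degree_over_def
  proof (intro arg_cong2[where f = "(\<and>)"] iffI)
    assume "\<exists>p. p \<noteq> 0 \<and> (\<forall>i. coeff p i \<in> ?K) \<and> poly p (fps_to_fls F) = 0 \<and> degree p = n"
    then show "\<exists>P. P \<noteq> 0 \<and> eval_series P F = 0 \<and> degree P = n" using down by blast
  next
    assume "\<exists>P. P \<noteq> 0 \<and> eval_series P F = 0 \<and> degree P = n"
    then show "\<exists>p. p \<noteq> 0 \<and> (\<forall>i. coeff p i \<in> ?K) \<and> poly p (fps_to_fls F) = 0 \<and> degree p = n"
      using up by blast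
  next
    assume L: "\<forall>p. p \<noteq> 0 \<and> (\<forall>i. coeff p i \<in> ?K) \<and> poly p (fps_to_fls F) = 0 \<longrightarrow> n \<le> degree p"
    show "\<forall>P. P \<noteq> 0 \<and> eval_series P F = 0 \<longrightarrow> n \<le> degree P"
    proof (intro allI impI)
      fix P assume "P \<noteq> 0 \<and> eval_series P F = 0"
      then show "n \<le> degree P" using L[rule_format, of "map_poly ?e P"] up[of P] by simp
    qed
  next
    assume R: "\<forall>P. P \<noteq> 0 \<and> eval_series P F = 0 \<longrightarrow> n \<le> degree P"
    show "\<forall>p. p \<noteq> 0 \<and> (\<forall>i. coeff p i \<in> ?K) \<and> poly p (fps_to_fls F) = 0 \<longrightarrow> n \<le> degree p"
    proof (intro allI impI)
      fix p assume "p \<noteq> 0 \<and> (\<forall>i. coeff p i \<in> ?K) \<and> poly p (fps_to_fls F) = 0"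
      then obtain P where "P \<noteq> 0" "eval_series P F = 0" "degree P = degree p"
        using down by blast
      then show "n \<le> degree p" using R by metis
    qed
  qed
qed

text \<open>
  Once there is no nontrivial linear equation, a nontrivial equation of degree at most 2 has degree
  exactly 2. Stating the criterion with arbitrary coefficients that are not all zero avoids having to
  prove that a transformed equation has a nonzero leading coefficient.
\<close>

lemma quadratic_iff:
  fixes F :: "'a::field fps"
  shows "has_degree_over rational_functions (fps_to_fls F) 2 \<longleftrightarrow>
    (\<exists>a b c. (a \<noteq> 0 \<or> b \<noteq> 0 \<or> c \<noteq> 0) \<and>
       fps_of_poly a * F ^ 2 + fps_of_poly b * F + fps_of_poly c = 0) \<and>
    (\<forall>b c. fps_of_poly b * F + fps_of_poly c = 0 \<longrightarrow> b = 0 \<and> c = 0)"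
    (is "_ \<longleftrightarrow> ?E \<and> ?I")
proof -
  have ev2: "eval_series [:c, b, a:] F = fps_of_poly a * F ^ 2 + fps_of_poly b * F + fps_of_poly c"
    for a b c by (simp add: eval_series_pCons power2_eq_square algebra_simps)
  have ev1: "eval_series [:c, b:] F = fps_of_poly b * F + fps_of_poly c"
    for b c by (simp add: eval_series_pCons algebra_simps)
  have I: "?I \<longleftrightarrow> (\<forall>P. P \<noteq> 0 \<and> eval_series P F = 0 \<longrightarrow> 2 \<le> degree P)" (is "_ \<longleftrightarrow> ?J")
  proof
    assume I: ?I
    show ?J
    proof (intro allI impI, rule ccontr)
      fix P assume P: "P \<noteq> 0 \<and> eval_series P F = 0" and "\<not> 2 \<le> degree P"
      then have "degree P \<le> 1" by simp
      then obtain b c where "P = [:c, b:]" by (rule poly_degree_le_1E)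
      then show False using P I by (auto simp: ev1)
    qed
  next
    assume J: ?J
    show ?I
    proof (intro allI impI)
      fix b c assume "fps_of_poly b * F + fps_of_poly c = 0"
      then have "eval_series [:c, b:] F = 0" unfolding ev1 .
      moreover have "\<not> 2 \<le> degree [:c, b:]" by simp
      ultimately have "[:c, b:] = 0" using J by blast
      then show "b = 0 \<and> c = 0" by simp
    qed
  qed
  have E: "?E \<longleftrightarrow> (\<exists>P. P \<noteq> 0 \<and> eval_series P F = 0 \<and> degree P = 2)" if J: ?J
  proof
    assume ?E
    then obtain a b c where nz: "a \<noteq> 0 \<or> b \<noteq> 0 \<or> c \<noteq> 0"
      and "fps_of_poly a * F ^ 2 + fps_of_poly b * F + fps_of_poly c = 0" by blast
    then have "eval_series [:c, b, a:] F = 0" "[:c, b, a:] \<noteq> 0"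
      unfolding ev2 by auto
    moreover have "degree [:c, b, a:] \<le> 2" by simp
    ultimately show "\<exists>P. P \<noteq> 0 \<and> eval_series P F = 0 \<and> degree P = 2"
      using J order_antisym by blast
  next
    assume "\<exists>P. P \<noteq> 0 \<and> eval_series P F = 0 \<and> degree P = 2"
    then obtain P where P: "P \<noteq> 0" "eval_series P F = 0" "degree P \<le> 2" by auto
    from P(3) obtain a b c where "P = [:c, b, a:]" by (rule poly_degree_le_2E)
    with P(1,2) ev2[of c b a] show ?E by auto
  qed
  show ?thesis
    unfolding has_degree_over_rational_functions_iff using I E by blast
qed

text \<open>
  Since $G = t/(s - F)$ means $F = s - t/G$, substituting into $A F^2 + B F + C = 0$ and clearing
  $G^2$ gives an equation for $G$. Its constant term $A t^2$ is nonzero, so it is nontrivial. In the same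
  way, a linear equation for $G$ would give one for $F$.
\<close>

lemma quadratic_moebius:
  fixes F G :: "'a::field fps"
  assumes quad: "has_degree_over rational_functions (fps_to_fls F) 2"
    and G: "G * (fps_of_poly s - F) = fps_of_poly t" and t: "t \<noteq> 0"
  shows "has_degree_over rational_functions (fps_to_fls G) 2"
proof -
  define S T where "S = fps_of_poly s" and "T = fps_of_poly t"
  have G: "G * F = G * S - T" using G by (simp add: S_def T_def algebra_simps)
  from quad obtain a b c where nz: "a \<noteq> 0 \<or> b \<noteq> 0 \<or> c \<noteq> 0"
    and root: "fps_of_poly a * F ^ 2 + fps_of_poly b * F + fps_of_poly c = 0"
    and indep: "\<And>b c. fps_of_poly b * F + fps_of_poly c = 0 \<Longrightarrow> b = 0 \<and> c = 0"
    unfolding quadratic_iff by blast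
  have a: "a \<noteq> 0" using nz root indep[of b c] by auto
  define A B C where "A = fps_of_poly a" and "B = fps_of_poly b" and "C = fps_of_poly c"
  \<comment> \<open>Every occurrence of \<open>F\<close> is absorbed into a product \<open>G * F\<close>, which \<open>G\<close> rewrites.\<close>
  have "0 = G ^ 2 * (A * F ^ 2 + B * F + C)" using root by (simp add: A_def B_def C_def)
  also have "\<dots> = A * (G * F) ^ 2 + B * (G * F) * G + C * G ^ 2"
    by (simp add: power2_eq_square algebra_simps)
  also have "\<dots> = (A * S ^ 2 + B * S + C) * G ^ 2 + (- (B * T) - A * S * T - A * S * T) * G + A * T ^ 2"
    unfolding G by (simp add: power2_eq_square algebra_simps)
  finally have "fps_of_poly (a * s ^ 2 + b * s + c) * G ^ 2
      + fps_of_poly (- (b * t) - a * s * t - a * s * t) * G + fps_of_poly (a * t ^ 2) = 0"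
    by (simp add: fps_of_poly_simps fps_of_poly_diff fps_of_poly_uminus A_def B_def C_def S_def T_def)
  moreover have "a * t ^ 2 \<noteq> 0" using a t by simp
  moreover have "b = 0 \<and> c = 0" if eq: "fps_of_poly b * G + fps_of_poly c = 0" for b c
  proof -
    have "0 = (fps_of_poly b * G + fps_of_poly c) * (S - F)" using eq by simp
    also have "\<dots> = fps_of_poly b * (G * S - G * F) + fps_of_poly c * (S - F)"
      by (simp add: algebra_simps)
    also have "\<dots> = fps_of_poly (- c) * F + fps_of_poly (b * t + c * s)"
      unfolding G S_def T_def
      by (simp add: fps_of_poly_simps fps_of_poly_uminus algebra_simps)
    finally have "- c = 0 \<and> b * t + c * s = 0" using indep by metis
    then show ?thesis using t by auto
  qed
  ultimately show ?thesis unfolding quadratic_iff by blast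
qed

section \<open>The primitive irreducible polynomial\<close>

text \<open>
  Gauss's lemma in the form in which it undoes the factor introduced by pseudo-division: the content
  of the cofactor absorbs the whole constant.
\<close>

lemma primitive_dvd_of_dvd_smult:
  fixes P Q :: "'a::{factorial_semiring, semiring_Gcd, normalization_semidom_multiplicative, idom} poly"
  assumes "Q dvd smult c P" "c \<noteq> 0" "content Q = 1"
  shows "Q dvd P"
proof -
  obtain S where S: "smult c P = Q * S" using assms(1) by (elim dvdE)
  have "normalize c * content P = content S"
    using arg_cong[OF S, of content] assms(3) by (simp add: content_mult)
  then have "c dvd content S" by (metis dvd_triv_left normalize_dvd_iff)
  then have "[:c:] dvd S" by (simp add: const_poly_dvd_iff_dvd_content)
  then obtain R where "S = smult c R" by (auto elim!: dvdE)
  then have "smult c P = smult c (Q * R)" using S by simp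
  then have "P = Q * R"
    using smult_cancel[OF assms(2)] by blast
  then show ?thesis by simp
qed

text \<open>
  Any factorisation of the primitive part \<open>Q\<close> of a quadratic equation puts the root \<open>F\<close> into one
  factor, which then has the full degree 2, and leaves a constant that divides the
  content 1. Pseudo-division of another equation by \<open>Q\<close> leaves a remainder of degree below 2 that
  vanishes at \<open>F\<close>, hence is zero.
\<close>

lemma unique_primitive_irreducible:
  fixes F :: "bit fps"
  assumes quad: "quadratic_series F"
  obtains Q where "degree Q = 2" "\<And>P. is_primitive_irreducible_of F P \<longleftrightarrow> P = Q"
proof -
  from quad obtain Q0 where Q0: "Q0 \<noteq> 0" "eval_series Q0 F = 0" "degree Q0 = 2"
    and min: "\<And>P. P \<noteq> 0 \<Longrightarrow> eval_series P F = 0 \<Longrightarrow> 2 \<le> degree P"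
    unfolding has_degree_over_rational_functions_iff by blast
  define Q where "Q = primitive_part Q0"
  have degQ: "degree Q = 2" and Qnz: "Q \<noteq> 0" and contQ: "content Q = 1"
    using Q0 by (simp_all add: Q_def)
  have "fps_of_poly (content Q0) * eval_series Q F = 0"
    using Q0(2) by (simp flip: eval_series_smult add: Q_def)
  moreover have "fps_of_poly (content Q0) \<noteq> 0"
    using Q0(1) fps_of_poly_eq_iff[of "content Q0" 0] by simp
  ultimately have rootQ: "eval_series Q F = 0" by simp
  have const_unit: "P dvd 1" if P: "degree P = 0" "P dvd Q" for P
  proof -
    obtain c where "P = [:c:]" using P(1) by (rule degree_eq_zeroE)
    then show ?thesis
      using P(2) contQ by (simp add: const_poly_dvd_iff_dvd_content is_unit_const_poly_iff)
  qed
  have irrQ: "irreducible Q"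
  proof (rule irreducibleI)
    show "Q \<noteq> 0" by fact
    show "\<not> Q dvd 1" using degQ by (auto simp: is_unit_poly_iff)
    fix S T assume ST: "Q = S * T"
    then have nz: "S \<noteq> 0" "T \<noteq> 0" using Qnz by auto
    have deg: "degree S + degree T = 2" using degQ ST nz by (simp add: degree_mult_eq)
    have "eval_series S F = 0 \<or> eval_series T F = 0"
      using rootQ by (simp add: ST eval_series_mult)
    then have "degree S = 0 \<or> degree T = 0"
      using min[of S] min[of T] nz deg by auto
    then show "S dvd 1 \<or> T dvd 1"
      using const_unit[of S] const_unit[of T] ST by auto
  qed
  have "P = Q" if P: "is_primitive_irreducible_of F P" for P
  proof -
    obtain d S where d: "d \<noteq> 0" and S: "smult d P = Q * S + pseudo_mod P Q"
      using pseudo_mod(1)[OF Qnz, of P] by blast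
    have "eval_series (smult d P) F = 0"
      using P by (simp add: eval_series_smult is_primitive_irreducible_of_def)
    then have "eval_series (pseudo_mod P Q) F = 0"
      unfolding S eval_series_add eval_series_mult rootQ by simp
    then have "pseudo_mod P Q = 0"
      using min[of "pseudo_mod P Q"] pseudo_mod(2)[OF Qnz, of P] degQ
      by (metis not_le)
    then have "Q dvd smult d P" using S by simp
    then have "Q dvd P" using d contQ by (rule primitive_dvd_of_dvd_smult)
    then obtain u where u: "P = Q * u" ..
    moreover have "irreducible P" using P by (simp add: is_primitive_irreducible_of_def)
    ultimately have "u dvd 1" using irreducibleD[of P Q u] irrQ by (auto simp: irreducible_def)
    \<comment> \<open>A unit is a constant of degree 0 in both variables, and the only unit of the coefficient field is 1.\<close>
    then obtain e where "u = [:[:e:]:]" "e dvd 1" by (auto simp: is_unit_poly_iff)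
    then have "u = 1" by (cases e) (simp_all add: one_pCons)
    with u show ?thesis by simp
  qed
  moreover have "is_primitive_irreducible_of F Q"
    using irrQ contQ rootQ by (simp add: is_primitive_irreducible_of_def)
  ultimately show ?thesis using that degQ by blast
qed

lemma primitive_irreducible_of:
  assumes "quadratic_series F"
  shows "\<exists>!P. is_primitive_irreducible_of F P"
    and "is_primitive_irreducible_of F (primitive_irreducible_of F)"
    and "degree (primitive_irreducible_of F) = 2"
proof -
  obtain Q where Q: "degree Q = 2" "\<And>P. is_primitive_irreducible_of F P \<longleftrightarrow> P = Q"
    using unique_primitive_irreducible[OF assms] by blast
  then have eq: "primitive_irreducible_of F = Q"
    unfolding primitive_irreducible_of_def by (intro the_equality) simp_all
  show "\<exists>!P. is_primitive_irreducible_of F P"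
    and "is_primitive_irreducible_of F (primitive_irreducible_of F)"
    and "degree (primitive_irreducible_of F) = 2"
    unfolding eq using Q by auto
qed

section \<open>The continued fraction step and its code\<close>

lemma q_int_eq_fps_of_poly: "q_int a = fps_of_poly (\<Sum>j<a. monom 1 j)"
  by (simp add: q_int_def fps_of_poly_sum fps_of_poly_monom')

lemma cf_step_quadratic:
  assumes "fps_nth F 0 = 1" "quadratic_series F"
  shows "fps_nth (cf_step F) 0 = 1" "quadratic_series (cf_step F)"
proof -
  note ex = quadratic_series_has_zero_coeff[OF assms]
  show "fps_nth (cf_step F) 0 = 1" using cf_step_exact(4)[OF assms(1) ex] .
  have "cf_step F * (fps_of_poly (\<Sum>j<cf_digit F. monom 1 j) - F)
      = fps_of_poly (monom 1 (cf_digit F - 1))"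
    using cf_step_exact(2)[OF assms(1) ex]
    by (simp add: q_int_eq_fps_of_poly fps_of_poly_monom')
  then show "quadratic_series (cf_step F)"
    by (rule quadratic_moebius[OF assms(2)]) simp
qed

lemma cf_tail_quadratic:
  assumes "fps_nth F 0 = 1" "quadratic_series F"
  shows "fps_nth (cf_tail F i) 0 = 1 \<and> quadratic_series (cf_tail F i)"
  unfolding cf_tail_def by (induction i) (use assms in \<open>simp_all add: cf_step_quadratic\<close>)

lemma cf_tail_add: "cf_tail F (i + j) = cf_tail (cf_tail F i) j"
  by (simp add: cf_tail_def funpow_add add.commute[of i j])

lemma cf_code_add: "cf_code F (i + j) = cf_code (cf_tail F i) j"
  by (simp add: cf_code_def cf_tail_add)

lemma fps_eq_0_if_all_X_power_dvd:
  fixes f :: "'a::field fps"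
  assumes "\<And>n. fps_X ^ n dvd f"
  shows "f = 0"
proof (rule ccontr)
  assume "f \<noteq> 0"
  then have "subdegree (fps_X ^ Suc (subdegree f) :: 'a fps) \<le> subdegree f"
    using assms by (intro dvd_imp_subdegree_le)
  then show False by simp
qed

text \<open>
  Removing a common first digit divides the difference of two series by \<open>X\<close> at least once, up to
  units. Hence \<open>n\<close> common digits give agreement to order at least \<open>n\<close>.
\<close>

lemma cf_code_eq_imp_X_power_dvd:
  assumes "fps_nth F 0 = 1" "quadratic_series F" "fps_nth G 0 = 1" "quadratic_series G"
    and "cf_code F = cf_code G"
  shows "fps_X ^ n dvd F - G"
  using assms
proof (induction n arbitrary: F G)
  case 0
  show ?case by simp
next
  case (Suc n)
  define F' G' where "F' = cf_step F" and "G' = cf_step G"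
  note exF = quadratic_series_has_zero_coeff[OF Suc.prems(1,2)]
  note exG = quadratic_series_has_zero_coeff[OF Suc.prems(3,4)]
  have code_Suc: "cf_code H (Suc j) = cf_code (cf_step H) j" for H j
    using cf_code_add[of H 1 j] by (simp add: cf_tail_def)
  have dig: "cf_digit G = cf_digit F"
    using fun_cong[OF Suc.prems(5), of 0] by (simp add: cf_code_def cf_tail_def)
  \<comment> \<open>Digits are at least 2, so the exponent in the numerator of the step is positive.\<close>
  obtain m where m: "cf_digit F - 1 = Suc m"
  proof -
    define z where "z = (LEAST j. 1 \<le> j \<and> fps_nth F j = 0)"
    have "1 \<le> z" using LeastI_ex[of "\<lambda>j. 1 \<le> j \<and> fps_nth F j = 0"] exF unfolding z_def by auto
    then show ?thesis using that[of "z - 1"] by (simp add: cf_digit_def z_def)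
  qed
  have F': "F' * (q_int (cf_digit F) - F) = fps_X ^ Suc m"
    and G': "G' * (q_int (cf_digit F) - G) = fps_X ^ Suc m"
    using cf_step_exact(2)[OF Suc.prems(1) exF] cf_step_exact(2)[OF Suc.prems(3) exG] m dig
    by (simp_all add: F'_def G'_def)
  have IH: "fps_X ^ n dvd F' - G'"
    unfolding F'_def G'_def
    by (rule Suc.IH)
      (use cf_step_quadratic Suc.prems in \<open>auto simp: fun_eq_iff simp flip: code_Suc\<close>)
  have "(F - G) * (F' * G') =
      F' * (G' * (q_int (cf_digit F) - G)) - G' * (F' * (q_int (cf_digit F) - F))"
    by (simp add: algebra_simps)
  also have "\<dots> = (F' - G') * fps_X ^ m * fps_X"
    unfolding F' G' by (simp add: algebra_simps)
  finally have "fps_X ^ Suc n dvd (F - G) * (F' * G')"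
    using IH by (simp add: mult_dvd_mono mult.commute)
  moreover have "F' * G' dvd 1"
    using cf_step_quadratic Suc.prems by (simp add: F'_def G'_def)
  ultimately show ?case by (simp only: dvd_mult_unit_iff)
qed

lemma cf_code_inject:
  assumes "fps_nth F 0 = 1" "quadratic_series F" "fps_nth G 0 = 1" "quadratic_series G"
    and "cf_code F = cf_code G"
  shows "F = G"
  using fps_eq_0_if_all_X_power_dvd[OF cf_code_eq_imp_X_power_dvd[OF assms]] by simp

section \<open>Finitely many tails\<close>

text \<open>
  By injectivity of the code, one recurrence of the code is a recurrence of the tail itself, after
  which every tail repeats one from the first \<open>N + p\<close>. Conversely, the pigeonhole
  principle gives two equal tails.
\<close>

lemma eventually_periodic_iff_finite_tails:
  assumes "fps_nth F 0 = 1" "quadratic_series F"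
  shows "eventually_periodic (cf_code F) \<longleftrightarrow> finite (range (cf_tail F))"
proof
  assume "eventually_periodic (cf_code F)"
  then obtain N p where p: "p > 0" and per: "\<And>i. i \<ge> N \<Longrightarrow> cf_code F (i + p) = cf_code F i"
    unfolding eventually_periodic_def by blast
  have "cf_code (cf_tail F (N + p)) = cf_code (cf_tail F N)"
    using per[of "N + j" for j] by (simp add: fun_eq_iff add_ac flip: cf_code_add)
  then have return: "cf_tail F (N + p) = cf_tail F N"
    using cf_tail_quadratic[OF assms] by (intro cf_code_inject) auto
  have "cf_tail F i \<in> cf_tail F ` {..<N + p}" for i
  proof (induction i rule: less_induct)
    case (less i)
    show ?case
    proof (cases "i < N + p")
      case False
      have "cf_tail F i = cf_tail (cf_tail F (N + p)) (i - (N + p))"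
        using False by (simp flip: cf_tail_add)
      also have "\<dots> = cf_tail F (i - p)"
        unfolding return using False by (simp flip: cf_tail_add)
      finally show ?thesis using less[of "i - p"] False p by simp
    qed simp
  qed
  then have "range (cf_tail F) \<subseteq> cf_tail F ` {..<N + p}" by blast
  then show "finite (range (cf_tail F))" by (rule finite_subset) simp
next
  assume "finite (range (cf_tail F))"
  then have "\<not> inj (cf_tail F)" using finite_imageD infinite_UNIV_nat by blast
  then obtain i j where "i < j" and eq: "cf_tail F i = cf_tail F j"
    unfolding inj_def by (metis linorder_neqE_nat)
  have "cf_code F (n + (j - i)) = cf_code F n" if "n \<ge> i" for n
    using cf_code_add[of F j "n - i"] cf_code_add[of F i "n - i"] eq that \<open>i < j\<close>
    by (simp add: add.commute)
  then show "eventually_periodic (cf_code F)"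
    unfolding eventually_periodic_def using \<open>i < j\<close> zero_less_diff by blast
qed

text \<open>
  The coefficient set is arbitrary because this is used twice: for polynomials over the field of two
  elements, and then for polynomials whose coefficients are such polynomials of bounded degree.
\<close>

lemma finite_polys_bounded_degree:
  assumes "finite A"
  shows "finite {p. degree p \<le> n \<and> (\<forall>i. coeff p i \<in> A)}" (is "finite ?S")
proof -
  have "?S \<subseteq> Poly ` {xs. set xs \<subseteq> A \<and> length xs \<le> Suc n}"
  proof
    fix p assume p: "p \<in> ?S"
    then have "length (coeffs p) \<le> Suc n" by (auto simp: degree_eq_length_coeffs)
    moreover have "set (coeffs p) \<subseteq> A" using p by (auto simp: coeffs_def split: if_splits)
    ultimately show "p \<in> Poly ` {xs. set xs \<subseteq> A \<and> length xs \<le> Suc n}"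
      by (intro image_eqI[of _ _ "coeffs p"]) simp_all
  qed
  then show ?thesis
    by (rule finite_subset) (intro finite_imageI finite_lists_length_le assms)
qed

lemma finite_bit_polys: "finite {p :: bit poly. degree p \<le> n}"
proof -
  have "{p. degree p \<le> n} = {p. degree p \<le> n \<and> (\<forall>i. coeff p i \<in> {0, 1 :: bit})}" by auto
  then show ?thesis using finite_polys_bounded_degree[of "{0, 1 :: bit}" n] by simp
qed

text \<open>
  With bounded degrees, all tails are roots of finitely many nonzero polynomials over the integral
  domain of power series, and each of these has finitely many roots.
\<close>

lemma finite_tails_iff_bounded_degrees:
  assumes "fps_nth F 0 = 1" "quadratic_series F"
  shows "finite (range (cf_tail F)) \<longleftrightarrow>
    (\<forall>k\<le>2. bounded_degrees (\<lambda>i. coeff (primitive_irreducible_of (cf_tail F i)) k))"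
proof (intro iffI allI impI)
  fix k
  assume "finite (range (cf_tail F))"
  then have "finite ((\<lambda>G. degree (coeff (primitive_irreducible_of G) k)) ` range (cf_tail F))"
    by (rule finite_imageI)
  then show "bounded_degrees (\<lambda>i. coeff (primitive_irreducible_of (cf_tail F i)) k)"
    by (simp add: bounded_degrees_def image_image bdd_above_finite)
next
  let ?P = "\<lambda>i. primitive_irreducible_of (cf_tail F i)"
  assume bd: "\<forall>k\<le>2. bounded_degrees (\<lambda>i. coeff (?P i) k)"
  then have "\<forall>k\<in>{..2}. \<exists>b. \<forall>i. degree (coeff (?P i) k) \<le> b"
    by (auto simp: bounded_degrees_def bdd_above_def)
  then obtain b where b: "\<And>k i. k \<le> 2 \<Longrightarrow> degree (coeff (?P i) k) \<le> b k"
    by (auto dest!: bchoice)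
  define n where "n = Max (b ` {..2})"
  have quad: "quadratic_series (cf_tail F i)" for i using cf_tail_quadratic[OF assms] by blast
  note P = primitive_irreducible_of[OF quad]
  have coeff_bd: "degree (coeff (?P i) k) \<le> n" for i k
  proof (cases "k \<le> 2")
    case True
    then have "b k \<le> n" unfolding n_def by (intro Max_ge) auto
    then show ?thesis using b[OF True, of i] by linarith
  next
    case False
    then show ?thesis by (simp add: coeff_eq_0 P(3))
  qed
  define S where "S = {P :: bit poly poly. degree P \<le> 2 \<and> (\<forall>i. coeff P i \<in> {p. degree p \<le> n})}"
  have "finite S" unfolding S_def by (rule finite_polys_bounded_degree[OF finite_bit_polys])
  have "range (cf_tail F) \<subseteq>
      (\<Union>P\<in>S - {0}. {G. eval_series P G = 0})"
  proof clarify
    fix i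
    have "?P i \<in> S - {0}" using P(3)[of i] coeff_bd by (auto simp: S_def)
    moreover have "eval_series (?P i) (cf_tail F i) = 0"
      using P(2) by (simp add: is_primitive_irreducible_of_def)
    ultimately show "cf_tail F i \<in> (\<Union>P\<in>S - {0}. {G. eval_series P G = 0})" by blast
  qed
  moreover have "finite {G. eval_series P G = 0}" if "P \<noteq> 0" for P :: "bit poly poly"
    using that fps_of_poly_eq_iff[of _ 0] by (intro poly_roots_finite) (simp add: map_poly_eq_0_iff)
  ultimately show "finite (range (cf_tail F))"
    using \<open>finite S\<close> by (elim finite_subset) auto
qed

theorem theorem8p4:
  fixes F :: "bit fps"
  assumes "fps_nth F 0 = 1"
    and "quadratic_series F"
  shows "(\<forall>i. quadratic_series (cf_tail F i)) \<and>
    (\<forall>i. \<exists>!P. is_primitive_irreducible_of (cf_tail F i) P) \<and>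
    (\<forall>i. degree (primitive_irreducible_of (cf_tail F i)) = 2) \<and>
    (eventually_periodic (cf_code F) \<longleftrightarrow>
      bounded_degrees (\<lambda>i. coeff (primitive_irreducible_of (cf_tail F i)) 2) \<and>
      bounded_degrees (\<lambda>i. coeff (primitive_irreducible_of (cf_tail F i)) 1) \<and>
      bounded_degrees (\<lambda>i. coeff (primitive_irreducible_of (cf_tail F i)) 0))"
proof -
  have quad: "quadratic_series (cf_tail F i)" for i
    using cf_tail_quadratic[OF assms] by blast
  have le_2: "(\<forall>k\<le>2. Q k) \<longleftrightarrow> Q 2 \<and> Q 1 \<and> Q 0" for Q :: "nat \<Rightarrow> bool"
    by (auto simp: numeral_2_eq_2 le_Suc_eq)
  show ?thesis
    using quad primitive_irreducible_of[OF quad]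
      eventually_periodic_iff_finite_tails[OF assms]
      finite_tails_iff_bounded_degrees[OF assms, unfolded le_2]
    by blast
qed

end
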